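(* Let $G_1$ and $G_2$ be simple connected graphs on $n_1$ and $n_2$ vertices, with signless Laplacians $Q_1,Q_2$, and let $G=G_1\circ G_2$ be their corona, with signless Laplacian $Q$. Then, as an identity of rational functions in $\lambda$, \[ f_Q (\lambda ) = (f_{Q_2 } (\lambda - 1))^{n_1 } f_{Q_1}\left(\lambda - n_2 + 1 -( - 1)^{n_2} \frac{f_{\overline{Q_2} }\left( n_2 - \lambda -1 \right)}{f_{Q_2} (\lambda-1 )}\right). \]
   Context: For a simple graph $H$ on $m$ vertices, $Q(H)=D(H)+A(H)$ is its signless Laplacian (degree diagonal matrix plus adjacency matrix). $f_Q(\lambda)=\det(\lambda I-Q)$ for $Q=Q(G)$, $f_{Q_i}(\lambda)=\det(\lambda I_{n_i}-Q_i)$, and $f_{\overline{Q_2}}(\lambda)=\det(\lambda I_{n_2}-Q(\overline{G_2}))$ where $\overline{G_2}$ is the complement of $G_2$. The corona $G_1\circ G_2$ is obtained by taking one copy of $G_1$ and $n_1$ disjoint copies of $G_2$, and joining the $i$-th vertex of $G_1$ by an edge to every vertex of the $i$-th copy of $G_2$, for $i=1,\dots,n_1$. *)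

theory Defs
  imports
    "Graph_Theory.Graph_Theory"
    "Jordan_Normal_Form.Char_Poly"
    "HOL-Computational_Algebra.Polynomial_Factorial"
begin

text \<open>
  A finite simple graph is a \<^locale>\<open>pair_graph\<close>: an edge between u and v is represented
  by the two arcs (u, v) and (v, u), so the degree of a vertex is its out-degree.

  Matrices of a graph are taken with respect to a list vs of its vertices, in which each vertex
  occurs exactly once.
\<close>

definition degree_matrix :: "'a pair_pre_digraph \<Rightarrow> 'a list \<Rightarrow> real mat" where
  "degree_matrix G vs = mat (length vs) (length vs)
     (\<lambda>(i, j). if i = j then real (out_degree (with_proj G) (vs ! i)) else 0)"

definition adjacency_matrix :: "'a pair_pre_digraph \<Rightarrow> 'a list \<Rightarrow> real mat" where
  "adjacency_matrix G vs = mat (length vs) (length vs)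
     (\<lambda>(i, j). if (vs ! i, vs ! j) \<in> parcs G then 1 else 0)"

definition signless_laplacian :: "'a pair_pre_digraph \<Rightarrow> 'a list \<Rightarrow> real mat" where
  "signless_laplacian G vs = degree_matrix G vs + adjacency_matrix G vs"

definition complement_graph :: "'a pair_pre_digraph \<Rightarrow> 'a pair_pre_digraph" where
  "complement_graph G = \<lparr> pverts = pverts G,
     parcs = {(u, v). u \<in> pverts G \<and> v \<in> pverts G \<and> u \<noteq> v \<and> (u, v) \<notin> parcs G} \<rparr>"

text \<open>
  In the corona, Inl u is the vertex u of the copy of the first graph, and Inr (u, x) is the
  vertex x of that copy of the second graph which belongs to u.
\<close>

definition corona ::
  "'a pair_pre_digraph \<Rightarrow> 'b pair_pre_digraph \<Rightarrow> ('a + 'a \<times> 'b) pair_pre_digraph" where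
  "corona G H = \<lparr> pverts = pverts G <+> (pverts G \<times> pverts H),
     parcs = {(Inl u, Inl v) | u v. (u, v) \<in> parcs G}
       \<union> {(Inr (u, x), Inr (u, y)) | u x y. u \<in> pverts G \<and> (x, y) \<in> parcs H}
       \<union> {(Inl u, Inr (u, x)) | u x. u \<in> pverts G \<and> x \<in> pverts H}
       \<union> {(Inr (u, x), Inl u) | u x. u \<in> pverts G \<and> x \<in> pverts H} \<rparr>"

text \<open>
  Rational functions in one indeterminate over the reals are elements of the fraction field of
  \<^typ>\<open>real poly\<close>. A real polynomial is evaluated at a rational function by
  embedding its coefficients as constants.
\<close>

definition ratfun_var :: "real poly fract" where
  "ratfun_var = to_fract [:0, 1:]"

definition eval_ratfun :: "real poly \<Rightarrow> real poly fract \<Rightarrow> real poly fract" where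
  "eval_ratfun p r = poly (map_poly (\<lambda>c. to_fract [:c:]) p) r"

lemma pair_graph_complement_graph:
  assumes "pair_graph G"
  shows "pair_graph (complement_graph G)"
proof -
  interpret pair_graph G by fact
  have "finite (parcs (complement_graph G))"
    by (rule finite_subset[of _ "pverts G \<times> pverts G"])
       (auto simp: complement_graph_def pair_finite_verts)
  then show ?thesis
    using pair_finite_verts
    by unfold_locales
       (auto simp: complement_graph_def symmetric_def sym_def arcs_symmetric)
qed

lemma pair_graph_corona:
  assumes "pair_graph G" "pair_graph H"
  shows "pair_graph (corona G H)"
proof -
  interpret G: pair_graph G by fact
  interpret H: pair_graph H by fact
  have fin: "finite (pverts (corona G H))"
    by (simp add: corona_def G.pair_finite_verts H.pair_finite_verts)
  have sub: "parcs (corona G H) \<subseteq> pverts (corona G H) \<times> pverts (corona G H)"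
    by (auto simp: corona_def G.wellformed' H.wellformed' Plus_def image_iff)
  then have "finite (parcs (corona G H))"
    by (rule finite_subset) (simp add: fin)
  moreover have "sym (parcs (corona G H))"
    by (auto simp: corona_def sym_def G.arcs_symmetric H.arcs_symmetric)
  moreover have "fst e \<noteq> snd e" if "e \<in> parcs (corona G H)" for e
    using that G.no_loops' H.no_loops' by (auto simp: corona_def)
  ultimately show ?thesis
    using fin sub by unfold_locales (auto simp: symmetric_def)
qed

lemma eval_ratfun_to_fract: "eval_ratfun p (to_fract q) = to_fract (pcompose p q)"
  by (induction p) (simp_all add: eval_ratfun_def map_poly_pCons pcompose_pCons)

text \<open>
  Division in \<^typ>\<open>real poly fract\<close> is total; the following lemma says that
  the denominator f(\<lambda> - 1) of the corona formula is not zero.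
\<close>

lemma eval_char_poly_ratfun_var_minus_1_neq_0:
  assumes "A \<in> carrier_mat n n"
  shows "eval_ratfun (char_poly A) (ratfun_var - 1) \<noteq> 0"
proof -
  have "ratfun_var - 1 = to_fract [:-1, 1:]"
    by (simp add: ratfun_var_def to_fract_diff[symmetric] to_fract_1[symmetric] one_pCons
        del: to_fract_1 to_fract_diff)
  moreover have "char_poly A \<noteq> 0"
    using degree_monic_char_poly[OF assms] by auto
  then have "pcompose (char_poly A) [:-1, 1:] \<noteq> 0"
    by (simp add: pcompose_eq_0_iff)
  ultimately show ?thesis
    by (simp add: eval_ratfun_to_fract)
qed

end

theory Submission
  imports Defs
begin

text \<open>
  Let \<open>B = (\<lambda> - 1) I - Q\<^sub>2\<close>, which is invertible over the field of
  rational functions, let \<open>w\<close> solve \<open>B w = 1\<close> (the all-ones vector), and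
  let \<open>s\<close> be the sum of the entries of \<open>w\<close>. With the vertices of \<open>G\<^sub>1\<close>
  listed first, the lower right block of \<open>\<lambda> I - Q\<close> consists of
  \<open>n\<^sub>1\<close> diagonal copies of \<open>B\<close>, and its Schur complement is
  \<open>(\<lambda> - n\<^sub>2 - s) I - Q\<^sub>1\<close>. Since the signless Laplacian of the complement of
  \<open>G\<^sub>2\<close> is \<open>(n\<^sub>2 - 2) I + J - Q\<^sub>2\<close>, its characteristic polynomial at
  \<open>n\<^sub>2 - \<lambda> - 1\<close> is \<open>det (- (B + J))\<close>, and
  \<open>det (B + J) = (1 + s) det B\<close> by the matrix determinant lemma, which identifies \<open>s\<close>.
\<close>

section \<open>Matrices with rows and columns named by list elements\<close>

text \<open>Entries depend on the named elements rather than on positions, so concatenating lists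
  gives block matrices and reordering a list permutes rows and columns together.\<close>

definition list_mat :: "'a list \<Rightarrow> 'b list \<Rightarrow> ('a \<Rightarrow> 'b \<Rightarrow> 'c) \<Rightarrow> 'c mat" where
  "list_mat xs ys f = mat (length xs) (length ys) (\<lambda>(i, j). f (xs ! i) (ys ! j))"

lemma list_mat_carrier [simp]: "list_mat xs ys f \<in> carrier_mat (length xs) (length ys)"
  by (simp add: list_mat_def)

lemma dim_list_mat [simp]:
  "dim_row (list_mat xs ys f) = length xs" "dim_col (list_mat xs ys f) = length ys"
  by (simp_all add: list_mat_def)

lemma index_list_mat [simp]:
  "i < length xs \<Longrightarrow> j < length ys \<Longrightarrow> list_mat xs ys f $$ (i, j) = f (xs ! i) (ys ! j)"
  by (simp add: list_mat_def)

lemma list_mat_cong: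
  assumes "\<And>x y. x \<in> set xs \<Longrightarrow> y \<in> set ys \<Longrightarrow> f x y = g x y"
  shows "list_mat xs ys f = list_mat xs ys g"
  using assms by (intro eq_matI) auto

lemma list_mat_map: "list_mat (map g xs) (map h ys) f = list_mat xs ys (\<lambda>x y. f (g x) (h y))"
  by (intro eq_matI) auto

lemma list_mat_append:
  "list_mat (xs @ ys) (xs @ ys) f =
     four_block_mat (list_mat xs xs f) (list_mat xs ys f) (list_mat ys xs f) (list_mat ys ys f)"
  by (intro eq_matI) (auto simp: nth_append)

lemma sum_nth_distinct:
  assumes "distinct xs"
  shows "(\<Sum>i = 0..<length xs. f (xs ! i)) = sum f (set xs)"
  using assms sum.distinct_set_conv_list[of xs f] by (simp add: sum_list_sum_nth)

lemma list_mat_mult: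
  assumes "distinct ys"
  shows "list_mat xs ys f * list_mat ys zs g = list_mat xs zs (\<lambda>x z. \<Sum>y\<in>set ys. f x y * g y z)"
proof (intro eq_matI)
  fix i j
  assume ij: "i < dim_row (list_mat xs zs (\<lambda>x z. \<Sum>y\<in>set ys. f x y * g y z))"
    "j < dim_col (list_mat xs zs (\<lambda>x z. \<Sum>y\<in>set ys. f x y * g y z))"
  then show "(list_mat xs ys f * list_mat ys zs g) $$ (i, j) =
      list_mat xs zs (\<lambda>x z. \<Sum>y\<in>set ys. f x y * g y z) $$ (i, j)"
    using sum_nth_distinct[OF assms, of "\<lambda>y. f (xs ! i) y * g y (zs ! j)"]
    by (simp add: scalar_prod_def)
qed auto

text \<open>Rows and columns undergo the same permutation, so its sign enters twice and squares to
  1. This frees the determinant from the chosen vertex order.\<close>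

lemma det_list_mat_mset_eq:
  assumes "mset xs = mset ys"
  shows "det (list_mat xs xs f) = det (list_mat ys ys (f :: 'a \<Rightarrow> 'a \<Rightarrow> 'c :: comm_ring_1))"
proof -
  define n where "n = length ys"
  obtain p where p: "p permutes {..<n}" and xs: "permute_list p ys = xs"
    using mset_eq_permutation[OF assms] n_def by blast
  have len: "length xs = n" using mset_eq_length[OF assms] n_def by simp
  have p0: "p permutes {0..<n}" using p by (simp add: lessThan_atLeast0)
  have lt: "p i < n" if "i < n" for i using permutes_in_image[OF p] that by auto
  have nth: "xs ! i = ys ! p i" if "i < n" for i
    using that permute_list_nth[of p ys i] p xs n_def by auto
  \<comment> \<open>\<open>?B\<close> permutes the rows of \<open>?A\<close>; \<open>?C\<close>
    permutes the rows of the transpose of \<open>?B\<close>, that is, its columns. The reordered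
    matrix is therefore the transpose of \<open>?C\<close>.\<close>
  let ?A = "list_mat ys ys f"
  let ?B = "mat n n (\<lambda>(i, j). ?A $$ (p i, j))"
  let ?C = "mat n n (\<lambda>(i, j). transpose_mat ?B $$ (p i, j))"
  have A: "?A \<in> carrier_mat n n" by (simp add: n_def)
  have B: "transpose_mat ?B \<in> carrier_mat n n" "?B \<in> carrier_mat n n" by auto
  have C: "?C \<in> carrier_mat n n" by auto
  have "list_mat xs xs f = transpose_mat ?C"
    by (intro eq_matI) (use lt nth len in \<open>auto simp: n_def\<close>)
  then have "det (list_mat xs xs f) = det ?C"
    by (simp only: det_transpose[OF C])
  also have "\<dots> = signof p * det ?B"
    by (subst det_permute_rows[OF B(1) p0]) (simp only: det_transpose[OF B(2)])
  also have "\<dots> = signof p * signof p * det ?A"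
    by (subst det_permute_rows[OF A p0]) simp
  also have "signof p * signof p = (1 :: 'c)"
    by (simp add: sign_def)
  finally show ?thesis by simp
qed

section \<open>Block determinants and Schur complements\<close>

text \<open>Right multiplication by the unit lower triangular \<open>?P\<close> subtracts
  \<open>D * X = C\<close> from the lower left block. A solution \<open>X\<close> in place of an
  inverse of \<open>D\<close> keeps the argument inside an integral domain.\<close>

lemma det_schur:
  fixes A :: "'a :: idom mat"
  assumes A: "A \<in> carrier_mat n n" and B: "B \<in> carrier_mat n m"
    and C: "C \<in> carrier_mat m n" and D: "D \<in> carrier_mat m m"
    and X: "X \<in> carrier_mat m n" and DX: "D * X = C"
  shows "det (four_block_mat A B C D) = det (A - B * X) * det D"
proof -
  let ?P = "four_block_mat (1\<^sub>m n) (0\<^sub>m n m) (- X) (1\<^sub>m m)"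
  have P: "?P \<in> carrier_mat (n + m) (n + m)"
    by (rule four_block_carrier_mat) auto
  have M: "four_block_mat A B C D \<in> carrier_mat (n + m) (n + m)"
    by (rule four_block_carrier_mat[OF A D])
  have "det ?P = 1"
    using X by (subst det_four_block_mat_upper_right_zero[of _ n _ m]) auto
  moreover have "four_block_mat A B C D * ?P =
      four_block_mat (A * 1\<^sub>m n + B * (- X)) (A * 0\<^sub>m n m + B * 1\<^sub>m m)
        (C * 1\<^sub>m n + D * (- X)) (C * 0\<^sub>m n m + D * 1\<^sub>m m)"
    by (rule mult_four_block_mat) (use A B C D X in auto)
  moreover have "A * 1\<^sub>m n + B * (- X) = A - B * X"
    using A B X add_uminus_minus_mat[of A n n "B * X"] by simp
  moreover have "C * 1\<^sub>m n + D * (- X) = 0\<^sub>m m n"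
    using C D X DX minus_r_inv_mat[OF C] add_uminus_minus_mat[OF C C] by simp
  moreover have "A * 0\<^sub>m n m + B * 1\<^sub>m m = B" "C * 0\<^sub>m n m + D * 1\<^sub>m m = D"
    using A B C D by auto
  ultimately have "det (four_block_mat A B C D) = det (four_block_mat (A - B * X) B (0\<^sub>m m n) D)"
    using det_mult[OF M P] by simp
  also have "\<dots> = det (A - B * X) * det D"
    by (rule det_four_block_mat_lower_left_zero) (use A B D X in auto)
  finally show ?thesis .
qed

text \<open>Here \<open>g\<close> gives the entries of the \<open>X\<close> in
  \<open>det_schur\<close>; the second assumption is \<open>D * X = C\<close> written
  entrywise.\<close>

lemma det_list_mat_append:
  fixes f :: "'a \<Rightarrow> 'a \<Rightarrow> 'c :: idom"
  assumes "distinct ys"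
    and "\<And>x y. x \<in> set xs \<Longrightarrow> y \<in> set ys \<Longrightarrow> (\<Sum>z\<in>set ys. f y z * g z x) = f y x"
  shows "det (list_mat (xs @ ys) (xs @ ys) f) =
    det (list_mat xs xs (\<lambda>x x'. f x x' - (\<Sum>y\<in>set ys. f x y * g y x'))) * det (list_mat ys ys f)"
proof -
  have "list_mat ys ys f * list_mat ys xs g = list_mat ys xs f"
    unfolding list_mat_mult[OF assms(1)] by (rule list_mat_cong) (use assms(2) in auto)
  from det_schur[where A = "list_mat xs xs f" and B = "list_mat xs ys f",
      OF list_mat_carrier list_mat_carrier list_mat_carrier list_mat_carrier list_mat_carrier this]
  have "det (list_mat (xs @ ys) (xs @ ys) f) =
      det (list_mat xs xs f - list_mat xs ys f * list_mat ys xs g) * det (list_mat ys ys f)"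
    by (simp add: list_mat_append)
  also have "list_mat xs xs f - list_mat xs ys f * list_mat ys xs g =
      list_mat xs xs (\<lambda>x x'. f x x' - (\<Sum>y\<in>set ys. f x y * g y x'))"
    unfolding list_mat_mult[OF assms(1)] by (intro eq_matI) auto
  finally show ?thesis .
qed

text \<open>The matrix is block diagonal with one copy of the same block per element of
  \<open>us\<close>; the induction splits off the first copy.\<close>

lemma det_list_mat_product:
  fixes f :: "'b \<Rightarrow> 'b \<Rightarrow> 'c :: idom"
  assumes "distinct us"
  shows "det (list_mat (List.product us xs) (List.product us xs)
      (\<lambda>p q. if fst p = fst q then f (snd p) (snd q) else 0)) = det (list_mat xs xs f) ^ length us"
  using assms
proof (induction us)
  case Nil
  have "list_mat [] [] g \<in> carrier_mat 0 0" for g :: "'a \<times> 'b \<Rightarrow> 'a \<times> 'b \<Rightarrow> 'c"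
    by (simp add: list_mat_def)
  then show ?case by simp
next
  case (Cons u us)
  let ?f = "\<lambda>p q. if fst p = fst q then f (snd p) (snd q) else 0"
  let ?l = "map (Pair u) xs" and ?r = "List.product us xs"
  \<comment> \<open>By distinctness \<open>u\<close> does not occur in \<open>us\<close>, so no pair
    in \<open>?r\<close> shares its first component with \<open>?l\<close>.\<close>
  have "list_mat ?r ?l ?f = 0\<^sub>m (length ?r) (length ?l)"
  proof (intro eq_matI)
    fix i j
    assume ij: "i < dim_row (0\<^sub>m (length ?r) (length ?l) :: 'c mat)"
      "j < dim_col (0\<^sub>m (length ?r) (length ?l) :: 'c mat)"
    then have "?r ! i \<in> set ?r" by (intro nth_mem) auto
    then have "fst (?r ! i) \<noteq> u" using Cons.prems by auto
    then show "list_mat ?r ?l ?f $$ (i, j) = 0\<^sub>m (length ?r) (length ?l) $$ (i, j)"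
      using ij by simp
  qed auto
  then have "det (list_mat (?l @ ?r) (?l @ ?r) ?f) = det (list_mat ?l ?l ?f) * det (list_mat ?r ?r ?f)"
    unfolding list_mat_append
    by (intro det_four_block_mat_lower_left_zero[OF list_mat_carrier list_mat_carrier _ list_mat_carrier])
  moreover have "list_mat ?l ?l ?f = list_mat xs xs f"
    by (simp add: list_mat_map)
  ultimately show ?case
    using Cons by simp
qed

section \<open>A linear system and the matrix determinant lemma\<close>

text \<open>The solution is the inverse matrix applied to the all-ones vector, so \<open>w\<close>
  consists of the row sums of the inverse \<open>B\<close>.\<close>

lemma list_mat_linear_system:
  fixes f :: "'a \<Rightarrow> 'a \<Rightarrow> 'c :: field"
  assumes "distinct xs" and "det (list_mat xs xs f) \<noteq> 0"
  obtains w where "\<And>x. x \<in> set xs \<Longrightarrow> (\<Sum>y\<in>set xs. f x y * w y) = 1"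
proof -
  let ?n = "length xs" and ?A = "list_mat xs xs f"
  obtain B where B: "B \<in> carrier_mat ?n ?n" and AB: "?A * B = 1\<^sub>m ?n"
    using det_non_zero_imp_unit[OF list_mat_carrier assms(2), of "()"]
    unfolding Units_def ring_mat_def by auto
  \<comment> \<open>\<open>inv_into\<close> recovers the position of \<open>y\<close> in the list,
    which is unique by distinctness.\<close>
  define w where "w y = (\<Sum>j = 0..<?n. B $$ (inv_into {0..<?n} ((!) xs) y, j))" for y
  have inj: "inj_on ((!) xs) {0..<?n}"
    using assms(1) by (simp add: inj_on_nth)
  have w: "w (xs ! i) = (\<Sum>j = 0..<?n. B $$ (i, j))" if "i < ?n" for i
    using inv_into_f_f[OF inj, of i] that by (simp add: w_def)
  have "(\<Sum>y\<in>set xs. f x y * w y) = 1" if x: "x \<in> set xs" for x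
  proof -
    obtain i where i: "i < ?n" "x = xs ! i" using x by (auto simp: in_set_conv_nth)
    have "(\<Sum>y\<in>set xs. f x y * w y) = (\<Sum>k = 0..<?n. ?A $$ (i, k) * (\<Sum>j = 0..<?n. B $$ (k, j)))"
      unfolding sum_nth_distinct[OF assms(1), of "\<lambda>y. f x y * w y", symmetric]
      by (intro sum.cong) (use i w in auto)
    also have "\<dots> = (\<Sum>j = 0..<?n. \<Sum>k = 0..<?n. ?A $$ (i, k) * B $$ (k, j))"
      unfolding sum_distrib_left by (rule sum.swap)
    also have "\<dots> = (\<Sum>j = 0..<?n. (?A * B) $$ (i, j))"
      using i B by (intro sum.cong) (auto simp: scalar_prod_def)
    also have "\<dots> = 1"
      using i by (simp add: AB)
    finally show ?thesis .
  qed
  then show thesis by (rule that)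
qed

text \<open>Both sides are the determinant of \<open>f\<close> bordered by a row of entries \<open>-1\<close>, a column of
  entries \<open>1\<close> and the corner \<open>1\<close>, evaluated by the two possible Schur complements.\<close>

lemma det_list_mat_add_one:
  fixes f :: "'a \<Rightarrow> 'a \<Rightarrow> 'c :: idom"
  assumes "distinct xs" and "\<And>x. x \<in> set xs \<Longrightarrow> (\<Sum>y\<in>set xs. f x y * w y) = 1"
  shows "det (list_mat xs xs (\<lambda>x y. f x y + 1)) = (1 + sum w (set xs)) * det (list_mat xs xs f)"
proof -
  define F where "F = (\<lambda>p q. case p of None \<Rightarrow> (case q of None \<Rightarrow> 1 | Some y \<Rightarrow> - 1)
    | Some x \<Rightarrow> (case q of None \<Rightarrow> 1 | Some y \<Rightarrow> f x y))"
  let ?xs = "map Some xs"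
  have dist: "distinct ?xs" using assms(1) by (simp add: distinct_map)
  have det1: "det (list_mat [None] [None] g) = g None None" for g :: "'a option \<Rightarrow> 'a option \<Rightarrow> 'c"
    by (subst det_single) (auto simp: list_mat_def)
  \<comment> \<open>Eliminating the block of \<open>f\<close>: its border column is all ones, so
    \<open>X\<close> is \<open>w\<close>, and the border row of entries -1 turns the corner into
    \<open>1 + sum w (set xs)\<close>.\<close>
  have "det (list_mat ([None] @ ?xs) ([None] @ ?xs) F) = (1 + sum w (set xs)) * det (list_mat ?xs ?xs F)"
    by (subst det_list_mat_append[OF dist, where g = "\<lambda>p _. w (the p)"])
      (use assms(2) in \<open>auto simp: F_def sum.reindex sum_negf det1\<close>)
  \<comment> \<open>Eliminating the corner 1 instead: \<open>X\<close> is the border row of entries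
    -1, and subtracting 1 times -1 adds 1 to every entry of \<open>f\<close>.\<close>
  moreover have "det (list_mat (?xs @ [None]) (?xs @ [None]) F) = det (list_mat ?xs ?xs (\<lambda>p q. F p q + 1))"
    by (subst det_list_mat_append[where g = "\<lambda>_ _. - 1"])
      (auto simp: F_def det1 intro!: arg_cong[where f = det] list_mat_cong)
  moreover have "det (list_mat ([None] @ ?xs) ([None] @ ?xs) F) = det (list_mat (?xs @ [None]) (?xs @ [None]) F)"
    by (rule det_list_mat_mset_eq) simp
  ultimately show ?thesis
    by (simp add: list_mat_map F_def)
qed

lemma det_list_mat_uminus:
  fixes f :: "'a \<Rightarrow> 'a \<Rightarrow> 'c :: comm_ring_1"
  shows "det (list_mat xs xs (\<lambda>x y. - f x y)) = (- 1) ^ length xs * det (list_mat xs xs f)"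
proof -
  have "list_mat xs xs (\<lambda>x y. - f x y) = (- 1) \<cdot>\<^sub>m list_mat xs xs f"
    by (intro eq_matI) auto
  then show ?thesis by simp
qed

section \<open>Characteristic polynomials evaluated at rational functions\<close>

lemma comm_ring_hom_const_ratfun: "comm_ring_hom (\<lambda>c :: real. to_fract [:c:])"
  by unfold_locales
    (simp_all add: to_fract_add[symmetric] to_fract_mult[symmetric] one_pCons[symmetric]
      del: to_fract_add to_fract_mult)

text \<open>Embedding constants is a ring homomorphism, so it commutes with
  \<open>char_poly\<close>, and evaluation at \<open>r\<close> passes into the determinant.
  Distinctness lets \<open>u = v\<close> detect the diagonal.\<close>

lemma eval_ratfun_char_poly:
  assumes "distinct vs"
  shows "eval_ratfun (char_poly (list_mat vs vs q)) r =
    det (list_mat vs vs (\<lambda>u v. (if u = v then r else 0) - to_fract [:q u v:]))"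
proof -
  interpret h: comm_ring_hom "\<lambda>c :: real. to_fract [:c:]"
    by (rule comm_ring_hom_const_ratfun)
  let ?H = "map_mat (\<lambda>c. to_fract [:c:]) (list_mat vs vs q)"
  have "map_poly (\<lambda>c. to_fract [:c:]) (char_poly (list_mat vs vs q)) = char_poly ?H"
    by (rule h.char_poly_hom[OF list_mat_carrier, symmetric])
  then have "eval_ratfun (char_poly (list_mat vs vs q)) r = poly (char_poly ?H) r"
    by (simp add: eval_ratfun_def)
  also have "\<dots> = det (list_mat vs vs (\<lambda>u v. (if u = v then r else 0) - to_fract [:q u v:]))"
    unfolding char_poly_def
    by (rule poly_det_cong[of _ "length vs"])
      (use assms in \<open>auto simp: char_poly_matrix_def nth_eq_iff_index_eq\<close>)
  finally show ?thesis .
qed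

section \<open>Determinants with the block pattern of a corona\<close>

text \<open>Schur complement of the copies: the copy at \<open>u\<close> meets only the row and
  column of \<open>Inl u\<close>, so it alters only that diagonal entry, by the sum of
  \<open>w\<close>.\<close>

lemma det_list_mat_corona:
  fixes b :: "'b \<Rightarrow> 'b \<Rightarrow> 'c :: idom" and F :: "'a + 'a \<times> 'b \<Rightarrow> 'a + 'a \<times> 'b \<Rightarrow> 'c"
  assumes "distinct us" and "distinct xs"
    and w: "\<And>x. x \<in> set xs \<Longrightarrow> (\<Sum>y\<in>set xs. b x y * w y) = 1"
    and lr: "\<And>u v y. u \<in> set us \<Longrightarrow> v \<in> set us \<Longrightarrow> y \<in> set xs \<Longrightarrow>
      F (Inl u) (Inr (v, y)) = (if u = v then - 1 else 0)"
    and rl: "\<And>u x v. u \<in> set us \<Longrightarrow> x \<in> set xs \<Longrightarrow> v \<in> set us \<Longrightarrow>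
      F (Inr (u, x)) (Inl v) = (if u = v then - 1 else 0)"
    and rr: "\<And>u x v y. u \<in> set us \<Longrightarrow> x \<in> set xs \<Longrightarrow> v \<in> set us \<Longrightarrow> y \<in> set xs \<Longrightarrow>
      F (Inr (u, x)) (Inr (v, y)) = (if u = v then b x y else 0)"
  defines "L \<equiv> map Inl us @ map Inr (List.product us xs)"
  shows "det (list_mat L L F) =
    det (list_mat us us (\<lambda>u v. F (Inl u) (Inl v) - (if u = v then sum w (set xs) else 0))) *
    det (list_mat xs xs b) ^ length us"
proof -
  let ?P = "List.product us xs"
  \<comment> \<open>Column \<open>Inl u\<close> of \<open>X\<close> is \<open>- w\<close> on the
    copy at \<open>u\<close> and 0 on the others, since \<open>b\<close> maps \<open>w\<close> to
    ones while the joining entries are -1. The projections are applied to \<open>Inr\<close> rows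
    and \<open>Inl\<close> columns.\<close>
  define g :: "'a + 'a \<times> 'b \<Rightarrow> 'a + 'a \<times> 'b \<Rightarrow> 'c"
    where "g p q = (if fst (projr p) = projl q then - w (snd (projr p)) else 0)" for p q
  have dist: "distinct (map Inr ?P :: ('a + 'a \<times> 'b) list)"
    using assms(1,2) by (simp add: distinct_map distinct_product)
  have sum: "(\<Sum>z\<in>set (map Inr ?P). h z) = (\<Sum>v\<in>set us. \<Sum>y\<in>set xs. h (Inr (v, y)))"
    for h :: "'a + 'a \<times> 'b \<Rightarrow> 'c"
    by (simp add: sum.reindex sum.cartesian_product)
  \<comment> \<open>Only the copy at \<open>u\<close> survives. This serves twice: with a row of the
    copies to check \<open>D * X = C\<close>, and with a row of the first graph to compute the
    complement.\<close>
  have row: "(\<Sum>z\<in>set (map Inr ?P). h z * g z (Inl u)) = - (\<Sum>y\<in>set xs. h (Inr (u, y)) * w y)"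
    if "u \<in> set us" for h :: "'a + 'a \<times> 'b \<Rightarrow> 'c" and u
  proof -
    have "(\<Sum>y\<in>set xs. h (Inr (v, y)) * g (Inr (v, y)) (Inl u)) =
        (if v = u then - (\<Sum>y\<in>set xs. h (Inr (u, y)) * w y) else 0)" for v
      by (simp add: g_def sum_negf)
    then show ?thesis
      unfolding sum using that by simp
  qed
  have "(\<Sum>z\<in>set (map Inr ?P). F q z * g z p) = F q p"
    if "p \<in> set (map Inl us)" "q \<in> set (map Inr ?P)" for p q
  proof -
    obtain u v x where pq: "p = Inl u" "q = Inr (v, x)" "u \<in> set us" "v \<in> set us" "x \<in> set xs"
      using \<open>p \<in> _\<close> \<open>q \<in> _\<close> by auto
    have "(\<Sum>y\<in>set xs. F q (Inr (u, y)) * w y) = (if v = u then 1 else 0)"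
      using pq w[of x] by (simp add: rr)
    then show ?thesis
      using row[of u "F q"] pq by (simp add: rl)
  qed
  from det_list_mat_append[OF dist, of "map Inl us" F g, OF this]
  have "det (list_mat L L F) =
      det (list_mat us us (\<lambda>u v. F (Inl u) (Inl v) -
        (\<Sum>z\<in>set (map Inr ?P). F (Inl u) z * g z (Inl v)))) *
      det (list_mat ?P ?P (\<lambda>p q. F (Inr p) (Inr q)))"
    by (simp add: L_def list_mat_map)
  also have "list_mat us us (\<lambda>u v. F (Inl u) (Inl v) -
        (\<Sum>z\<in>set (map Inr ?P). F (Inl u) z * g z (Inl v))) =
      list_mat us us (\<lambda>u v. F (Inl u) (Inl v) - (if u = v then sum w (set xs) else 0))"
  proof (rule list_mat_cong)
    fix u v
    assume "u \<in> set us" "v \<in> set us"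
    then show "F (Inl u) (Inl v) - (\<Sum>z\<in>set (map Inr ?P). F (Inl u) z * g z (Inl v)) =
        F (Inl u) (Inl v) - (if u = v then sum w (set xs) else 0)"
      unfolding row[OF \<open>v \<in> set us\<close>] by (simp add: lr sum_negf)
  qed
  also have "list_mat ?P ?P (\<lambda>p q. F (Inr p) (Inr q)) =
      list_mat ?P ?P (\<lambda>p q. if fst p = fst q then b (snd p) (snd q) else 0)"
    by (rule list_mat_cong) (auto simp: rr)
  finally show ?thesis
    by (simp add: det_list_mat_product[OF assms(1)])
qed

section \<open>Signless Laplacian entries of complements and coronas\<close>

definition signless_entry :: "'a pair_pre_digraph \<Rightarrow> 'a \<Rightarrow> 'a \<Rightarrow> real" where
  "signless_entry G u v = (if u = v then real (out_degree (with_proj G) u) else 0) +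
     (if (u, v) \<in> parcs G then 1 else 0)"

lemma signless_laplacian_list_mat:
  assumes "distinct vs"
  shows "signless_laplacian G vs = list_mat vs vs (signless_entry G)"
  by (intro eq_matI)
    (use assms in \<open>auto simp: signless_laplacian_def degree_matrix_def adjacency_matrix_def
      signless_entry_def nth_eq_iff_index_eq\<close>)

lemma out_degree_with_proj: "out_degree (with_proj G) u = card {v. (u, v) \<in> parcs G}"
proof -
  have "out_arcs (with_proj G) u = Pair u ` {v. (u, v) \<in> parcs G}"
    by (auto simp: out_arcs_def)
  then show ?thesis
    by (simp add: out_degree_def card_image inj_on_def)
qed

text \<open>A vertex, its neighbours and its non-neighbours partition the vertex set, so the two
  degrees add up to one less than its size. Adding 1 everywhere accounts for the off-diagonal
  entries and leaves the constant 2 on the diagonal.\<close>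

lemma signless_entry_complement_graph:
  assumes "pair_graph G" and "u \<in> pverts G" and "v \<in> pverts G"
  shows "signless_entry (complement_graph G) u v =
    (if u = v then real (card (pverts G)) - 2 else 0) + 1 - signless_entry G u v"
proof -
  interpret pair_graph G by fact
  let ?N = "{v. (u, v) \<in> parcs G}" and ?N' = "{v. (u, v) \<in> parcs (complement_graph G)}"
  have N: "?N \<subseteq> pverts G" "u \<notin> ?N"
    using wellformed' no_loops' by blast+
  have "pverts G = insert u (?N \<union> ?N')"
    using assms(2) N by (auto simp: complement_graph_def)
  moreover have "u \<notin> ?N \<union> ?N'" "?N \<inter> ?N' = {}"
    using N by (auto simp: complement_graph_def)
  moreover have "finite ?N" "finite ?N'"
    using N by (auto simp: complement_graph_def intro: finite_subset[OF _ pair_finite_verts])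
  ultimately have "card (pverts G) = 1 + card ?N + card ?N'"
    by (simp add: card_Un_disjoint)
  then have "real (out_degree (with_proj (complement_graph G)) u) =
      real (card (pverts G)) - 1 - real (out_degree (with_proj G) u)"
    by (simp add: out_degree_with_proj)
  then show ?thesis
    using assms(2,3) N by (auto simp: signless_entry_def complement_graph_def)
qed

lemma out_degree_corona_Inl:
  assumes "pair_graph G" and "pair_graph H" and "u \<in> pverts G"
  shows "out_degree (with_proj (corona G H)) (Inl u) =
    out_degree (with_proj G) u + card (pverts H)"
proof -
  interpret G: pair_graph G by fact
  interpret H: pair_graph H by fact
  let ?N = "{v. (u, v) \<in> parcs G}"
  have "finite ?N"
    by (rule finite_subset[OF _ G.pair_finite_verts]) (auto dest: G.wellformed')
  moreover have "{q. (Inl u, q) \<in> parcs (corona G H)} =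
      Inl ` ?N \<union> (\<lambda>x. Inr (u, x)) ` pverts H"
    using assms(3) by (auto simp: corona_def)
  moreover have "card (Inl ` ?N :: ('a + 'a \<times> 'b) set) = card ?N"
    "card ((\<lambda>x. Inr (u, x)) ` pverts H :: ('a + 'a \<times> 'b) set) = card (pverts H)"
    by (auto intro!: card_image inj_onI)
  moreover have "Inl ` ?N \<inter> (\<lambda>x. Inr (u, x)) ` pverts H = {}"
    by auto
  ultimately show ?thesis
    by (simp add: out_degree_with_proj card_Un_disjoint H.pair_finite_verts)
qed

lemma out_degree_corona_Inr:
  assumes "pair_graph H" and "u \<in> pverts G" and "x \<in> pverts H"
  shows "out_degree (with_proj (corona G H)) (Inr (u, x)) = out_degree (with_proj H) x + 1"
proof -
  interpret H: pair_graph H by fact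
  let ?N = "{y. (x, y) \<in> parcs H}"
  have "finite ?N"
    by (rule finite_subset[OF _ H.pair_finite_verts]) (auto dest: H.wellformed')
  moreover have "{q. (Inr (u, x), q) \<in> parcs (corona G H)} =
      insert (Inl u) ((\<lambda>y. Inr (u, y)) ` ?N)"
    using assms(2,3) by (auto simp: corona_def)
  moreover have "card ((\<lambda>y. Inr (u, y)) ` ?N) = card ?N"
    by (auto intro!: card_image inj_onI)
  ultimately show ?thesis
    by (simp add: out_degree_with_proj card_insert_if image_iff)
qed

text \<open>The joining edges raise the degree of \<open>Inl u\<close> by the order of
  \<open>H\<close> and that of each copy vertex by one, and supply the ones linking \<open>u\<close>
  to its own copy.\<close>

lemma signless_entry_corona:
  assumes "pair_graph G" and "pair_graph H" and "u \<in> pverts G"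
  shows "signless_entry (corona G H) (Inl u) (Inl v) =
      signless_entry G u v + (if u = v then real (card (pverts H)) else 0)"
    and "y \<in> pverts H \<Longrightarrow>
      signless_entry (corona G H) (Inl u) (Inr (v, y)) = (if u = v then 1 else 0)"
    and "x \<in> pverts H \<Longrightarrow>
      signless_entry (corona G H) (Inr (u, x)) (Inl v) = (if u = v then 1 else 0)"
    and "x \<in> pverts H \<Longrightarrow> signless_entry (corona G H) (Inr (u, x)) (Inr (v, y)) =
      (if u = v then signless_entry H x y + (if x = y then 1 else 0) else 0)"
proof -
  \<comment> \<open>Unfolding only the arc set keeps \<open>corona G H\<close> folded elsewhere, so
    that the degree rules still match.\<close>
  note parcs_corona = corona_def[of G H, THEN arg_cong[where f = parcs], unfolded pair_pre_digraph.simps]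
  note out_degree = out_degree_corona_Inl[OF assms(1,2)] out_degree_corona_Inr[OF assms(2)]
  show "signless_entry (corona G H) (Inl u) (Inl v) =
      signless_entry G u v + (if u = v then real (card (pverts H)) else 0)"
    using assms(3) by (auto simp: signless_entry_def out_degree parcs_corona)
  show "y \<in> pverts H \<Longrightarrow>
      signless_entry (corona G H) (Inl u) (Inr (v, y)) = (if u = v then 1 else 0)"
    using assms(3) by (auto simp: signless_entry_def corona_def)
  show "x \<in> pverts H \<Longrightarrow>
      signless_entry (corona G H) (Inr (u, x)) (Inl v) = (if u = v then 1 else 0)"
    using assms(3) by (auto simp: signless_entry_def corona_def)
  show "x \<in> pverts H \<Longrightarrow> signless_entry (corona G H) (Inr (u, x)) (Inr (v, y)) =
      (if u = v then signless_entry H x y + (if x = y then 1 else 0) else 0)"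
    using assms(3) by (auto simp: signless_entry_def out_degree parcs_corona)
qed

section \<open>The signless Laplacian characteristic polynomial of a corona\<close>

theorem theorem2p11:
  fixes G1 :: "'a pair_pre_digraph" and G2 :: "'b pair_pre_digraph"
    and vs1 :: "'a list" and vs2 :: "'b list" and vs :: "('a + 'a \<times> 'b) list"
    and n1 n2 :: nat
    and fQ fQ1 fQ2 fQ2c :: "real poly"
    and lam :: "real poly fract"
  assumes "pair_graph G1" and "connected (with_proj G1)" and "card (pverts G1) = n1"
    and "pair_graph G2" and "connected (with_proj G2)" and "card (pverts G2) = n2"
    and "distinct vs1" and "set vs1 = pverts G1"
    and "distinct vs2" and "set vs2 = pverts G2"
    and "distinct vs" and "set vs = pverts (corona G1 G2)"
  defines "fQ \<equiv> char_poly (signless_laplacian (corona G1 G2) vs)"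
    and "fQ1 \<equiv> char_poly (signless_laplacian G1 vs1)"
    and "fQ2 \<equiv> char_poly (signless_laplacian G2 vs2)"
    and "fQ2c \<equiv> char_poly (signless_laplacian (complement_graph G2) vs2)"
    and "lam \<equiv> ratfun_var"
  shows "eval_ratfun fQ lam =
    eval_ratfun fQ2 (lam - 1) ^ n1 *
    eval_ratfun fQ1
      (lam - of_nat n2 + 1 -
        (- 1) ^ n2 * (eval_ratfun fQ2c (of_nat n2 - lam - 1) / eval_ratfun fQ2 (lam - 1)))"
proof -
  interpret G1: pair_graph G1 by fact
  interpret G2: pair_graph G2 by fact
  interpret h: comm_ring_hom "\<lambda>c :: real. to_fract [:c:]"
    by (rule comm_ring_hom_const_ratfun)
  let ?h = "\<lambda>c :: real. to_fract [:c:]"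
  have len: "length vs1 = n1" "length vs2 = n2"
    using assms distinct_card by metis+
  have h_of_nat: "?h (real n) = of_nat n" for n
    by (rule h.hom_of_nat)
  \<comment> \<open>The shift to \<open>lam - 1\<close> absorbs the extra degree that the joining
    edge gives each copy vertex.\<close>
  define b where "b x y = (if x = y then lam - 1 else 0) - ?h (signless_entry G2 x y)" for x y
  have f2: "eval_ratfun fQ2 (lam - 1) = det (list_mat vs2 vs2 b)"
    unfolding fQ2_def b_def[abs_def] signless_laplacian_list_mat[OF \<open>distinct vs2\<close>]
    by (rule eval_ratfun_char_poly[OF \<open>distinct vs2\<close>])
  \<comment> \<open>This yields \<open>w\<close> and also permits the later division by
    \<open>eval_ratfun fQ2 (lam - 1)\<close>.\<close>
  have "det (list_mat vs2 vs2 b) \<noteq> 0"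
    unfolding f2[symmetric] fQ2_def lam_def
    by (rule eval_char_poly_ratfun_var_minus_1_neq_0[of _ n2])
      (simp add: signless_laplacian_list_mat assms len[symmetric])
  then obtain w where w: "\<And>x. x \<in> set vs2 \<Longrightarrow> (\<Sum>y\<in>set vs2. b x y * w y) = 1"
    using list_mat_linear_system \<open>distinct vs2\<close> by metis
  define s where "s = sum w (set vs2)"

  have "eval_ratfun fQ2c (of_nat n2 - lam - 1) = det (list_mat vs2 vs2 (\<lambda>x y. - (b x y + 1)))"
  proof -
    \<comment> \<open>On the diagonal, \<open>n2 - lam - 1\<close> minus \<open>n2 - 2\<close> is
      \<open>- (lam - 1)\<close>; the all-ones matrix contributes the remaining -1.\<close>
    have "(if x = y then of_nat n2 - lam - 1 else 0) - ?h (signless_entry (complement_graph G2) x y)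
        = - (b x y + 1)" if "x \<in> set vs2" "y \<in> set vs2" for x y
    proof -
      have "?h (signless_entry (complement_graph G2) x y) =
          (if x = y then of_nat n2 - 2 else 0) + 1 - ?h (signless_entry G2 x y)"
        using signless_entry_complement_graph[OF \<open>pair_graph G2\<close>, of x y] that assms
        by (simp only: h.hom_add h.hom_minus h.hom_one h.hom_zero h.hom_numeral h_of_nat if_distrib[of ?h])
      then show ?thesis by (simp add: b_def)
    qed
    then show ?thesis
      unfolding fQ2c_def signless_laplacian_list_mat[OF \<open>distinct vs2\<close>]
        eval_ratfun_char_poly[OF \<open>distinct vs2\<close>]
      by (intro arg_cong[where f = det] list_mat_cong)
  qed
  also have "\<dots> = (- 1) ^ n2 * ((1 + s) * eval_ratfun fQ2 (lam - 1))"
    using det_list_mat_add_one[OF \<open>distinct vs2\<close> w] len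
    by (simp only: det_list_mat_uminus f2 s_def)
  \<comment> \<open>The two factors \<open>(- 1) ^ n2\<close> multiply to 1, so the correction term
    is \<open>1 + s\<close>; its 1 then cancels the \<open>+ 1\<close> in the argument of
    \<open>fQ1\<close>.\<close>
  finally have "(- 1) ^ n2 * (eval_ratfun fQ2c (of_nat n2 - lam - 1) / eval_ratfun fQ2 (lam - 1)) = 1 + s"
    using \<open>det (list_mat vs2 vs2 b) \<noteq> 0\<close>
    by (simp add: f2 power_mult_distrib[symmetric] mult.assoc[symmetric])
  then have arg: "lam - of_nat n2 + 1 -
      (- 1) ^ n2 * (eval_ratfun fQ2c (of_nat n2 - lam - 1) / eval_ratfun fQ2 (lam - 1)) =
      lam - of_nat n2 - s"
    by simp

  define F where "F p q = (if p = q then lam else 0) - ?h (signless_entry (corona G1 G2) p q)" for p q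
  \<comment> \<open>The order of \<open>vs\<close> is arbitrary; \<open>?L\<close> puts the first
    graph before the copies, grouped by their vertex.\<close>
  let ?L = "map Inl vs1 @ map Inr (List.product vs1 vs2)"
  have "distinct ?L"
    using assms by (auto simp: distinct_map distinct_product)
  moreover have "set ?L = set vs"
    using assms by (auto simp: corona_def)
  ultimately have "mset vs = mset ?L"
    using \<open>distinct vs\<close> set_eq_iff_mset_eq_distinct by metis
  have entries: "F (Inl u) (Inr (v, y)) = (if u = v then - 1 else 0)"
    "F (Inr (u, x)) (Inl v) = (if u = v then - 1 else 0)"
    "F (Inr (u, x)) (Inr (v, y)) = (if u = v then b x y else 0)"
    if "u \<in> set vs1" "x \<in> set vs2" "y \<in> set vs2" for u v x y
    using that assms signless_entry_corona[OF \<open>pair_graph G1\<close> \<open>pair_graph G2\<close>, of u]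
    by (simp_all add: F_def b_def h.hom_add)
  have entry: "F (Inl u) (Inl v) =
      (if u = v then lam - of_nat n2 else 0) - ?h (signless_entry G1 u v)"
    if "u \<in> set vs1" for u v
    using that assms signless_entry_corona(1)[OF \<open>pair_graph G1\<close> \<open>pair_graph G2\<close>, of u]
    by (simp add: F_def h.hom_add h_of_nat)
  have "eval_ratfun fQ lam = det (list_mat vs vs F)"
    unfolding fQ_def F_def[abs_def] signless_laplacian_list_mat[OF \<open>distinct vs\<close>]
    by (rule eval_ratfun_char_poly[OF \<open>distinct vs\<close>])
  also have "\<dots> = det (list_mat ?L ?L F)"
    by (rule det_list_mat_mset_eq) fact
  also have "\<dots> = det (list_mat vs1 vs1 (\<lambda>u v. F (Inl u) (Inl v) - (if u = v then s else 0))) *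
      det (list_mat vs2 vs2 b) ^ length vs1"
    unfolding s_def by (rule det_list_mat_corona) (use assms w entries in auto)
  \<comment> \<open>The degree increase \<open>n2\<close> and the Schur correction \<open>s\<close>
    both sit on the diagonal, so they only shift the point at which \<open>fQ1\<close> is
    evaluated.\<close>
  also have "list_mat vs1 vs1 (\<lambda>u v. F (Inl u) (Inl v) - (if u = v then s else 0)) =
      list_mat vs1 vs1 (\<lambda>u v. (if u = v then lam - of_nat n2 - s else 0) - ?h (signless_entry G1 u v))"
    by (rule list_mat_cong) (simp add: entry)
  also have "det \<dots> = eval_ratfun fQ1 (lam - of_nat n2 - s)"
    unfolding fQ1_def signless_laplacian_list_mat[OF \<open>distinct vs1\<close>]
    by (rule eval_ratfun_char_poly[OF \<open>distinct vs1\<close>, symmetric])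
  finally show ?thesis
    unfolding arg by (simp only: f2 len mult.commute)
qed

end
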